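(* Let $H,K$ be finitely generated abelian groups, $n,m\ge3$, and let $\sigma\colon G\to S_n$, $\sigma'\colon G'\to S_m$ be surjective homomorphisms. Let $W=H^n\rtimes_\sigma G$ and $W'=K^m\rtimes_{\sigma'}G'$, and assume that every abelian normal subgroup of $W$ is contained in $H^n$ and every abelian normal subgroup of $W'$ is contained in $K^m$. If $\Phi\colon W\to W'$ is a group isomorphism, then: (1) $\Phi(H^n)=K^m$; (2) $H^n\cong K^m$; (3) $\mathrm{rk}(H)\,n=\mathrm{rk}(K)\,m$; (4) $T(H)^n\cong T(K)^m$; (5) $G\cong G'$.
   Context: $H^n\rtimes_\sigma G$ denotes the semidirect product in which $G$ acts on $H^n$ by permuting coordinates through $\sigma$: $g\cdot(h_1,\dots,h_n)=(h_{\sigma(g)(1)},\dots,h_{\sigma(g)(n)})$ (with the composition convention making this a left action); $H^n$ is identified with $\{(\mathbf h,1)\}$. For a finitely generated abelian group $A\cong\mathbb Z^r\oplus T$ with $T$ finite, $\mathrm{rk}(A)=r$ and $T(A)=T$ is its torsion subgroup. All groups are non-trivial. *)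

theory Defs
  imports "HOL-Algebra.Algebra"
begin

definition fin_gen_group :: "('a, 'b) monoid_scheme \<Rightarrow> bool" where
  "fin_gen_group A \<longleftrightarrow> (\<exists>S. finite S \<and> S \<subseteq> carrier A \<and> generate A S = carrier A)"

definition torsion_set :: "('a, 'b) monoid_scheme \<Rightarrow> 'a set" where
  "torsion_set A = {x \<in> carrier A. \<exists>k::nat. k > 0 \<and> x [^]\<^bsub>A\<^esub> k = \<one>\<^bsub>A\<^esub>}"

definition torsion_group :: "('a, 'b) monoid_scheme \<Rightarrow> ('a, 'b) monoid_scheme" where
  "torsion_group A = A\<lparr>carrier := torsion_set A\<rparr>"

definition ab_rank :: "('a, 'b) monoid_scheme \<Rightarrow> nat" where
  "ab_rank A = (THE r. (A Mod torsion_set A) \<cong> product_group {1..r} (\<lambda>_. integer_group))"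

definition dpow :: "('a, 'b) monoid_scheme \<Rightarrow> nat \<Rightarrow> (nat \<Rightarrow> 'a) monoid" where
  "dpow H n = product_group {1..n} (\<lambda>_. H)"

text \<open>Permutation action of G on H^n through sigma: G \<rightarrow> S_n (a left action):
  (g . h)_i = h_{sigma(g)^{-1}(i)}.\<close>
definition perm_act ::
  "('g, 'c) monoid_scheme \<Rightarrow> ('g \<Rightarrow> nat \<Rightarrow> nat) \<Rightarrow> nat \<Rightarrow> 'g \<Rightarrow> (nat \<Rightarrow> 'a) \<Rightarrow> (nat \<Rightarrow> 'a)" where
  "perm_act G \<sigma> n g h = (\<lambda>i\<in>{1..n}. h (\<sigma> (inv\<^bsub>G\<^esub> g) i))"

definition wreath_sdp ::
  "('a, 'b) monoid_scheme \<Rightarrow> nat \<Rightarrow> ('g, 'c) monoid_scheme \<Rightarrow> ('g \<Rightarrow> nat \<Rightarrow> nat)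
    \<Rightarrow> ((nat \<Rightarrow> 'a) \<times> 'g) monoid" where
  "wreath_sdp H n G \<sigma> =
    \<lparr> carrier = carrier (dpow H n) \<times> carrier G,
      monoid.mult = (\<lambda>(h, g) (h', g').
          (h \<otimes>\<^bsub>dpow H n\<^esub> perm_act G \<sigma> n g h', g \<otimes>\<^bsub>G\<^esub> g')),
      one = (\<one>\<^bsub>dpow H n\<^esub>, \<one>\<^bsub>G\<^esub>) \<rparr>"

definition base_sub :: "('a, 'b) monoid_scheme \<Rightarrow> nat \<Rightarrow> ('g, 'c) monoid_scheme
    \<Rightarrow> ((nat \<Rightarrow> 'a) \<times> 'g) set" where
  "base_sub H n G = carrier (dpow H n) \<times> {\<one>\<^bsub>G\<^esub>}"

definition abelian_normal :: "'a set \<Rightarrow> ('a, 'b) monoid_scheme \<Rightarrow> bool" where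
  "abelian_normal N W \<longleftrightarrow> N \<lhd> W \<and> (\<forall>x\<in>N. \<forall>y\<in>N. x \<otimes>\<^bsub>W\<^esub> y = y \<otimes>\<^bsub>W\<^esub> x)"

end

theory Submission
  imports Defs
begin

text \<open>The base group is an abelian normal subgroup, so by hypothesis it is the largest one; an
  isomorphism therefore carries one base onto the other and induces isomorphisms of the bases and
  of the quotients, which are \<open>G\<close> and \<open>G'\<close>. An isomorphism of the bases restricts to the torsion
  subgroups, and the torsion of a finite power is the power of the torsion. Modulo torsion the
  bases are free abelian of ranks \<open>rk(H) n\<close> and \<open>rk(K) m\<close>, and the rank of a free abelian group is
  an invariant.\<close>

section \<open>Finitely generated torsion-free abelian groups are free\<close>

context comm_group
begin

text \<open>The homomorphism from \<open>Z^I\<close> given by integer combinations of the family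
  \<open>x\<close>, written multiplicatively. Coefficients are total functions, so that generation
  can be stated through \<open>range\<close>; their values outside \<open>I\<close> do not affect
  the result. Indexing by \<open>I\<close> lets the generators change while the index set stays
  fixed.\<close>

definition span_map :: "'i set \<Rightarrow> ('i \<Rightarrow> 'a) \<Rightarrow> ('i \<Rightarrow> int) \<Rightarrow> 'a" where
  "span_map I x c = finprod G (\<lambda>i. x i [^] c i) I"

lemma span_map_closed: "x \<in> I \<rightarrow> carrier G \<Longrightarrow> span_map I x c \<in> carrier G"
  unfolding span_map_def by (intro finprod_closed) auto

lemma span_map_hom:
  assumes "x \<in> I \<rightarrow> carrier G"
  shows "span_map I x \<in> hom (product_group I (\<lambda>_. integer_group)) G"
proof (rule homI)
  fix c d
  have "span_map I x (\<lambda>i\<in>I. c i + d i) = finprod G (\<lambda>i. x i [^] c i \<otimes> x i [^] d i) I"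
    unfolding span_map_def using assms
    by (intro finprod_cong') (auto simp: int_pow_mult Pi_iff)
  also have "\<dots> = span_map I x c \<otimes> span_map I x d"
    unfolding span_map_def using assms by (intro finprod_multf) auto
  finally show "span_map I x (c \<otimes>\<^bsub>product_group I (\<lambda>_. integer_group)\<^esub> d)
      = span_map I x c \<otimes> span_map I x d" by simp
qed (use assms span_map_closed in auto)

lemma span_map_insert:
  assumes "finite I" "i \<notin> I" "x \<in> insert i I \<rightarrow> carrier G"
  shows "span_map (insert i I) x c = x i [^] c i \<otimes> span_map I x c"
  unfolding span_map_def using assms by (subst finprod_insert) auto

lemma span_map_cong:
  assumes "\<And>i. i \<in> I \<Longrightarrow> x i = y i" "\<And>i. i \<in> I \<Longrightarrow> c i = d i" "x \<in> I \<rightarrow> carrier G"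
  shows "span_map I x c = span_map I y d"
  unfolding span_map_def using assms by (intro finprod_cong') (auto simp: Pi_iff)

text \<open>An elementary change of generators paired with the opposite change of coefficients: the
  factor \<open>x i [^] (e * c j)\<close> gained at \<open>j\<close> is removed again at
  \<open>i\<close>.\<close>

lemma span_map_transvection:
  assumes "finite I" "i \<in> I" "j \<in> I" "i \<noteq> j" and x: "x \<in> I \<rightarrow> carrier G"
  shows "span_map I (x(j := x j \<otimes> x i [^] (e::int))) (c(i := c i - e * c j)) = span_map I x c"
proof -
  define J where "J = I - {i, j}"
  have I: "I = insert i (insert j J)" and J: "finite J" "i \<notin> insert j J" "j \<notin> J"
    using assms unfolding J_def by auto
  have xi: "x i \<in> carrier G" "x j \<in> carrier G" and xJ: "x \<in> J \<rightarrow> carrier G"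
    using assms unfolding J_def by auto
  define P where "P = span_map J x c"
  have P: "P \<in> carrier G" unfolding P_def using xJ by (rule span_map_closed)
  have split: "span_map I z d = z i [^] d i \<otimes> (z j [^] d j \<otimes> span_map J z d)"
    if "z \<in> I \<rightarrow> carrier G" for z d
    using that J unfolding I by (simp add: span_map_insert)
  let ?x = "x(j := x j \<otimes> x i [^] e)" and ?c = "c(i := c i - e * c j)"
  have "span_map J ?x ?c = P"
    unfolding P_def using J xJ by (intro span_map_cong) (auto simp: Pi_iff)
  moreover have "?x \<in> I \<rightarrow> carrier G" using x xi by (auto simp: Pi_iff)
  ultimately have "span_map I ?x ?c
      = x i [^] (c i - e * c j) \<otimes> ((x j \<otimes> x i [^] e) [^] c j \<otimes> P)"
    using split[of ?x ?c] \<open>i \<noteq> j\<close> by simp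
  also have "(x j \<otimes> x i [^] e) [^] c j = x i [^] (e * c j) \<otimes> x j [^] c j"
    using xi by (simp add: int_pow_distrib int_pow_pow m_comm)
  also have "x i [^] (c i - e * c j) \<otimes> (x i [^] (e * c j) \<otimes> x j [^] c j \<otimes> P)
      = (x i [^] (c i - e * c j) \<otimes> x i [^] (e * c j)) \<otimes> (x j [^] c j \<otimes> P)"
    using xi P by (simp add: m_assoc)
  also have "x i [^] (c i - e * c j) \<otimes> x i [^] (e * c j) = x i [^] c i"
    using xi by (simp flip: int_pow_mult)
  finally show ?thesis unfolding split[OF x] P_def .
qed

lemma span_map_remove:
  assumes "finite I" "i \<in> I" "x \<in> I \<rightarrow> carrier G" "x i [^] c i = \<one>"
  shows "span_map I x c = span_map (I - {i}) x c"
proof -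
  have "span_map (I - {i}) x c \<in> carrier G"
    using assms by (intro span_map_closed) auto
  then show ?thesis
    using assms span_map_insert[of "I - {i}" i x c] by (simp add: insert_absorb)
qed

text \<open>The image is a subgroup, and it contains each generator \<open>s\<close> as the image of
  the unit vector at \<open>s\<close>; hence it contains all that \<open>S\<close>
  generates.\<close>

lemma span_map_surj_generators:
  assumes "finite S" "S \<subseteq> carrier G" "generate G S = carrier G"
  shows "range (span_map S (\<lambda>s. s)) = carrier G"
proof -
  let ?Z = "product_group S (\<lambda>_. integer_group)"
  have x: "(\<lambda>s. s) \<in> S \<rightarrow> carrier G" using assms by auto
  interpret h: group_hom ?Z G "span_map S (\<lambda>s. s)"
    using span_map_hom[OF x] by (simp add: group_hom_def group_hom_axioms_def is_group)
  have sub: "subgroup (span_map S (\<lambda>s. s) ` carrier ?Z) G"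
    by (rule h.img_is_subgroup)
  have "s \<in> span_map S (\<lambda>s. s) ` carrier ?Z" if "s \<in> S" for s
  proof
    let ?c = "\<lambda>t\<in>S. if t = s then 1 else (0::int)"
    have "span_map S (\<lambda>s. s) ?c = finprod G (\<lambda>t. if s = t then t else \<one>) S"
      unfolding span_map_def using assms
      by (intro finprod_cong') (auto simp: int_pow_1)
    also have "\<dots> = s" using assms that by (subst finprod_singleton) auto
    finally show "s = span_map S (\<lambda>s. s) ?c" by simp
  qed auto
  then have "carrier G \<subseteq> span_map S (\<lambda>s. s) ` carrier ?Z"
    using generate_subgroup_incl[OF _ sub] assms by blast
  then show ?thesis using span_map_closed[OF x] by blast
qed

text \<open>Euclid's algorithm on the coefficients of a relation, each step being a transvection of the
  generators, shrinks the relation until it kills a single generator.\<close>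

lemma minimal_generators_independent:
  assumes torsion_free: "\<And>y k. y \<in> carrier G \<Longrightarrow> (k::nat) > 0 \<Longrightarrow> y [^] k = \<one> \<Longrightarrow> y = \<one>"
    and "finite I"
    and minimal: "\<And>J x. J \<subset> I \<Longrightarrow> x \<in> J \<rightarrow> carrier G \<Longrightarrow> range (span_map J x) \<noteq> carrier G"
    and "x \<in> I \<rightarrow> carrier G" "range (span_map I x) = carrier G" "span_map I x c = \<one>"
  shows "\<forall>i\<in>I. c i = 0"
  using assms(4-)
\<comment> \<open>Both \<open>x\<close> and \<open>c\<close> must be arbitrary, since a transvection
  changes the generators along with the relation.\<close>
proof (induction "\<Sum>i\<in>I. nat \<bar>c i\<bar>" arbitrary: x c rule: less_induct)
  case less
  show ?case
  proof (rule ccontr)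
    assume "\<not> ?case"
    then obtain j where j: "j \<in> I" "c j \<noteq> 0" by blast
    show False
    proof (cases "\<exists>i\<in>I. i \<noteq> j \<and> c i \<noteq> 0")
      case True
      then obtain k where k: "k \<in> I" "k \<noteq> j" "c k \<noteq> 0" by blast
      obtain p q where pq: "p \<in> I" "q \<in> I" "p \<noteq> q" "c p \<noteq> 0" "c q \<noteq> 0" "\<bar>c q\<bar> \<le> \<bar>c p\<bar>"
        using j k by (metis linear)
      \<comment> \<open>With this sign, \<open>e * c q\<close> has the sign of \<open>c p\<close>
        and absolute value \<open>\<bar>c q\<bar>\<close>, so the new coefficient at
        \<open>p\<close> has absolute value \<open>\<bar>c p\<bar> - \<bar>c q\<bar>\<close>. That
        is strictly smaller because \<open>c q\<close> is nonzero.\<close>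
      define e where "e = sgn (c p) * sgn (c q)"
      define x' where "x' = x(q := x q \<otimes> x p [^] e)"
      define c' where "c' = c(p := c p - e * c q)"
      have x': "x' \<in> I \<rightarrow> carrier G"
        unfolding x'_def using less.prems(1) pq by (auto simp: Pi_iff)
      \<comment> \<open>Every combination of \<open>x\<close> is thus a combination of
        \<open>x'\<close>, so the new family still generates.\<close>
      have trans: "span_map I x' (d(p := d p - e * d q)) = span_map I x d" for d
        unfolding x'_def using pq less.prems \<open>finite I\<close> by (intro span_map_transvection) auto
      have range: "range (span_map I x') = carrier G"
      proof
        show "carrier G \<subseteq> range (span_map I x')"
          using less.prems(2) trans by (metis (no_types, lifting) image_subset_iff rangeI)
      qed (use span_map_closed[OF x'] in auto)
      have small: "nat \<bar>c' p\<bar> < nat \<bar>c p\<bar>"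
        unfolding c'_def e_def using pq by (auto simp: sgn_if split: if_splits)
      have "(\<Sum>i\<in>I. nat \<bar>c' i\<bar>) < (\<Sum>i\<in>I. nat \<bar>c i\<bar>)"
      proof (rule sum_strict_mono_ex1)
        show "\<forall>i\<in>I. nat \<bar>c' i\<bar> \<le> nat \<bar>c i\<bar>" using small by (auto simp: c'_def)
      qed (use pq small \<open>finite I\<close> in blast)+
      moreover have "span_map I x' c' = \<one>"
        unfolding c'_def using trans less.prems(3) by simp
      \<comment> \<open>The induction hypothesis kills every coefficient of the new relation, but
        the one at \<open>q\<close> was left unchanged and is nonzero.\<close>
      ultimately have "c' q = 0" using less.hyps x' range pq by blast
      then show False unfolding c'_def using pq by simp
    next
      case False
      \<comment> \<open>Only \<open>c j\<close> is nonzero, so the relation reads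
        \<open>x j [^] c j = \<one>\<close>. Torsion-freeness makes \<open>x j\<close> trivial, and
        dropping \<open>j\<close> contradicts the minimality of \<open>I\<close>.\<close>
      have xj: "x j \<in> carrier G" using j less.prems by auto
      have "span_map I x c = finprod G (\<lambda>i. if j = i then x i [^] c i else \<one>) I"
        unfolding span_map_def using False less.prems(1)
        by (intro finprod_cong') (auto simp: Pi_iff)
      also have "\<dots> = x j [^] c j"
        using j \<open>finite I\<close> less.prems(1) by (subst finprod_singleton) (auto simp: Pi_iff)
      finally have "x j [^] c j = \<one>" using less.prems by simp
      \<comment> \<open>Torsion-freeness is stated for natural exponents, so a negative
        \<open>c j\<close> is first replaced by its absolute value.\<close>
      then have "x j [^] nat \<bar>c j\<bar> = \<one>"
        using xj by (smt (verit) int_pow_int int_pow_neg inv_one nat_0_le abs_ge_zero)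
      then have "x j = \<one>" using torsion_free[OF xj, of "nat \<bar>c j\<bar>"] j by simp
      then have "span_map I x d = span_map (I - {j}) x d" for d
        using j \<open>finite I\<close> less.prems(1) by (intro span_map_remove) auto
      then have "range (span_map (I - {j}) x) = carrier G"
        using less.prems(2) by (metis (no_types, lifting) image_cong)
      then show False using minimal[of "I - {j}" x] j less.prems by auto
    qed
  qed
qed

text \<open>A generating family with the fewest indices admits no nontrivial relation, so its
  combination map is injective as well as surjective. The index set has type \<open>'a set\<close>
  because the search starts from a finite generating subset of the group, indexed by itself.\<close>

lemma fin_gen_torsion_free_imp_free:
  assumes torsion_free: "\<And>y k. y \<in> carrier G \<Longrightarrow> (k::nat) > 0 \<Longrightarrow> y [^] k = \<one> \<Longrightarrow> y = \<one>"
    and "fin_gen_group G"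
  shows "\<exists>I :: 'a set. finite I \<and> product_group I (\<lambda>_. integer_group) \<cong> G"
proof -
  define P where "P = (\<lambda>I :: 'a set. finite I \<and>
    (\<exists>x. x \<in> I \<rightarrow> carrier G \<and> range (span_map I x) = carrier G))"
  obtain S where S: "finite S" "S \<subseteq> carrier G" "generate G S = carrier G"
    using assms(2) unfolding fin_gen_group_def by blast
  then have "P S"
    unfolding P_def using span_map_surj_generators[OF S] by (intro conjI exI[of _ "\<lambda>s. s"]) auto
  then obtain I where I: "P I" "\<And>J. P J \<Longrightarrow> card I \<le> card J"
    using ex_has_least_nat[of P S card] by blast
  then obtain x where fin: "finite I" and x: "x \<in> I \<rightarrow> carrier G" "range (span_map I x) = carrier G"
    unfolding P_def by blast
  have minimal: "range (span_map J z) \<noteq> carrier G" if "J \<subset> I" "z \<in> J \<rightarrow> carrier G" for J z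
  proof
    assume "range (span_map J z) = carrier G"
    then have "P J"
      using that finite_subset[OF psubset_imp_subset[OF that(1)] fin] unfolding P_def by blast
    then show False using I(2)[of J] psubset_card_mono[OF fin that(1)] by simp
  qed
  let ?Z = "product_group I (\<lambda>_. integer_group)"
  interpret h: group_hom ?Z G "span_map I x"
    using span_map_hom[OF x(1)] by (simp add: group_hom_def group_hom_axioms_def is_group)
  have "inj_on (span_map I x) (carrier ?Z)"
    unfolding h.inj_on_one_iff
  proof (intro allI impI ballI)
    fix c assume c: "c \<in> carrier ?Z" "span_map I x c = \<one>"
    then have "\<forall>i\<in>I. c i = 0"
      by (intro minimal_generators_independent[OF torsion_free fin minimal x])
    then show "c = \<one>\<^bsub>?Z\<^esub>" using c by (auto simp: PiE_iff extensional_def)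
  qed
  moreover have "span_map I x ` carrier ?Z = carrier G"
  proof -
    \<comment> \<open>The carrier of the product group holds extensional functions only; restricting
      to \<open>I\<close> reconciles it with \<open>range\<close>.\<close>
    have restrict: "span_map I x c = span_map I x (restrict c I)" for c
      using x by (intro span_map_cong) auto
    have "range (span_map I x) \<subseteq> span_map I x ` carrier ?Z"
    proof (rule image_subsetI)
      fix c
      have "restrict c I \<in> carrier ?Z" by (simp only: carrier_product_group) auto
      then show "span_map I x c \<in> span_map I x ` carrier ?Z" using restrict by blast
    qed
    then show ?thesis using x(2) h.hom_closed by blast
  qed
  ultimately have "span_map I x \<in> iso ?Z G"
    by (intro isoI h.homh) (simp add: bij_betw_def)
  then show ?thesis using fin is_isoI by blast
qed

end

section \<open>Finite powers of the integers as free abelian groups\<close>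

text \<open>Over a finite index set the finite-support condition is automatic. This gives access to
  the results on direct sums and free abelian groups.\<close>

lemma sum_group_eq_product_group:
  assumes "finite I" "\<And>i. i \<in> I \<Longrightarrow> group (G i)"
  shows "sum_group I G = product_group I G"
  using assms by (intro monoid.equality) (auto simp: carrier_sum_group)

lemma product_integer_group_iso_free_Abelian_group:
  "finite I \<Longrightarrow> product_group I (\<lambda>_. integer_group) \<cong> free_Abelian_group I"
  using isomorphic_sum_integer_group[of I] by (simp add: sum_group_eq_product_group)

text \<open>Each factor is free on a slice \<open>{i} \<times> J\<close>, a copy of
  \<open>J\<close>. The slices are pairwise disjoint, so the direct sum is free on their union
  \<open>I \<times> J\<close>.\<close>

lemma product_integer_group_power_iso:
  assumes "finite I" "finite J"
  shows "product_group I (\<lambda>_. product_group J (\<lambda>_. integer_group)) \<cong> free_Abelian_group (I \<times> J)"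
proof -
  have "product_group I (\<lambda>_. product_group J (\<lambda>_. integer_group))
      \<cong> product_group I (\<lambda>i. free_Abelian_group ({i} \<times> J))"
  proof (rule iso_product_groupI)
    fix i
    have "J \<approx> {i} \<times> J" by (simp add: eqpoll_sym times_singleton_eqpoll)
    then show "product_group J (\<lambda>_. integer_group) \<cong> free_Abelian_group ({i} \<times> J)"
      using product_integer_group_iso_free_Abelian_group[OF assms(2)] isomorphic_free_Abelian_groups
        iso_trans by blast
  qed auto
  also have "\<dots> = sum_group I (\<lambda>i. free_Abelian_group ({i} \<times> J))"
    using assms by (simp add: sum_group_eq_product_group)
  also have "\<dots> \<cong> free_Abelian_group (\<Union>i\<in>I. {i} \<times> J)"
    by (rule is_isoI[OF iso_free_Abelian_group_sum]) (auto simp: pairwise_def disjnt_def)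
  also have "(\<Union>i\<in>I. {i} \<times> J) = I \<times> J" by auto
  finally show ?thesis .
qed

section \<open>Torsion and rank\<close>

lemma (in comm_group) torsion_set_subgroup: "subgroup (torsion_set G) G"
proof
  fix x y assume "x \<in> torsion_set G" "y \<in> torsion_set G"
  then obtain k l :: nat where kl: "x \<in> carrier G" "k > 0" "x [^] k = \<one>"
      "y \<in> carrier G" "l > 0" "y [^] l = \<one>"
    unfolding torsion_set_def by blast
  have "(x \<otimes> y) [^] (k * l) = (x [^] k) [^] l \<otimes> (y [^] l) [^] k"
    using kl(1,4) by (simp add: pow_mult_distrib m_comm nat_pow_pow mult.commute)
  also have "\<dots> = \<one>" unfolding kl by simp
  finally show "x \<otimes> y \<in> torsion_set G"
    unfolding torsion_set_def using kl by (auto intro!: exI[of _ "k * l"])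
next
  fix x assume "x \<in> torsion_set G"
  then show "inv x \<in> torsion_set G"
    unfolding torsion_set_def by (auto simp: nat_pow_inv)
qed (auto simp: torsion_set_def intro: exI[of _ 1])

lemma (in comm_group) torsion_set_normal: "torsion_set G \<lhd> G"
  by (rule subgroup_imp_normal[OF torsion_set_subgroup])

lemma (in comm_group) torsion_set_coset_iff:
  "y \<in> carrier G \<Longrightarrow> torsion_set G #> y = torsion_set G \<longleftrightarrow> y \<in> torsion_set G"
  using coset_join1[OF _ _ torsion_set_subgroup] subgroup.rcos_const[OF torsion_set_subgroup]
    subgroup.subset[OF torsion_set_subgroup] is_group by blast

text \<open>If the class of \<open>y\<close> is killed by \<open>k\<close>, then
  \<open>y [^] k\<close> is torsion, killed by some \<open>l\<close>, and so \<open>k * l\<close>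
  kills \<open>y\<close>.\<close>

lemma (in comm_group) Mod_torsion_set_torsion_free:
  assumes "Y \<in> carrier (G Mod torsion_set G)" "(k::nat) > 0"
    "Y [^]\<^bsub>G Mod torsion_set G\<^esub> k = \<one>\<^bsub>G Mod torsion_set G\<^esub>"
  shows "Y = \<one>\<^bsub>G Mod torsion_set G\<^esub>"
proof -
  interpret N: normal "torsion_set G" G by (rule torsion_set_normal)
  obtain y where y: "y \<in> carrier G" "Y = torsion_set G #> y"
    using assms(1) by (auto simp: FactGroup_def RCOSETS_def)
  have "torsion_set G #> (y [^] k) = torsion_set G"
    using assms y N.FactGroup_pow[of y k] by (simp add: FactGroup_def)
  then have "y [^] k \<in> torsion_set G"
    using y by (simp add: torsion_set_coset_iff)
  then obtain l :: nat where "l > 0" "y [^] (k * l) = \<one>"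
    unfolding torsion_set_def using y by (auto simp: nat_pow_pow)
  then have "y \<in> torsion_set G"
    unfolding torsion_set_def using y assms(2) by (auto intro!: exI[of _ "k * l"])
  then show ?thesis using y N.rcos_const by (simp add: FactGroup_def)
qed

lemma (in group_hom) fin_gen_group_img:
  assumes "fin_gen_group G" "h ` carrier G = carrier H"
  shows "fin_gen_group H"
proof -
  obtain S where S: "finite S" "S \<subseteq> carrier G" "generate G S = carrier G"
    using assms(1) unfolding fin_gen_group_def by blast
  then have "generate H (h ` S) = carrier H" using generate_img assms(2) by simp
  moreover have "h ` S \<subseteq> carrier H" using S assms(2) by blast
  ultimately show ?thesis unfolding fin_gen_group_def using S(1) by blast
qed

text \<open>Justifies the definite description in \<open>ab_rank\<close>. The quotient is finitely
  generated and torsion-free, hence free of some finite rank; uniqueness holds because isomorphic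
  free abelian groups have equipotent bases.\<close>

lemma (in comm_group) Mod_torsion_set_iso_ab_rank:
  assumes "fin_gen_group G"
  shows "G Mod torsion_set G \<cong> product_group {1..ab_rank G} (\<lambda>_. integer_group)"
proof -
  let ?Q = "G Mod torsion_set G"
  interpret N: normal "torsion_set G" G by (rule torsion_set_normal)
  interpret Q: comm_group ?Q by (rule abelian_FactGroup[OF torsion_set_subgroup])
  interpret q: group_hom G ?Q "(#>) (torsion_set G)"
    using N.r_coset_hom_Mod by (simp add: group_hom_def group_hom_axioms_def is_group Q.is_group)
  have "fin_gen_group ?Q"
    by (rule q.fin_gen_group_img[OF assms]) (auto simp: FactGroup_def RCOSETS_def)
  then obtain I :: "'a set set" where I: "finite I" "product_group I (\<lambda>_. integer_group) \<cong> ?Q"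
    using Q.fin_gen_torsion_free_imp_free Mod_torsion_set_torsion_free by blast
  have free: "product_group {1..r} (\<lambda>_. integer_group) \<cong> free_Abelian_group {1..r}" for r :: nat
    by (rule product_integer_group_iso_free_Abelian_group) simp
  have "?Q \<cong> product_group I (\<lambda>_. integer_group)"
    using I by (simp add: group.iso_sym)
  also have "\<dots> \<cong> free_Abelian_group I"
    by (rule product_integer_group_iso_free_Abelian_group[OF I(1)])
  finally have QI: "?Q \<cong> free_Abelian_group I" .
  moreover have "free_Abelian_group I \<cong> free_Abelian_group {1..card I}"
    using I by (simp add: isomorphic_free_Abelian_groups eqpoll_iff_card)
  moreover have "free_Abelian_group {1..card I} \<cong> product_group {1..card I} (\<lambda>_. integer_group)"
    using free by (simp add: group.iso_sym)
  ultimately have ex: "?Q \<cong> product_group {1..card I} (\<lambda>_. integer_group)"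
    by (blast intro: iso_trans)
  have "r = card I" if "?Q \<cong> product_group {1..r} (\<lambda>_. integer_group)" for r
  proof -
    have "free_Abelian_group I \<cong> ?Q" using QI by (rule Q.iso_sym)
    with that free have "free_Abelian_group I \<cong> free_Abelian_group {1..r}"
      by (blast intro: iso_trans)
    then show ?thesis using I by (simp add: isomorphic_free_Abelian_groups eqpoll_iff_card)
  qed
  then show ?thesis unfolding ab_rank_def using ex by (metis (mono_tags, lifting) theI)
qed

section \<open>Torsion in finite products and powers\<close>

lemma nat_pow_product_group:
  assumes "x \<in> carrier (product_group I G)"
  shows "x [^]\<^bsub>product_group I G\<^esub> (k::nat) = (\<lambda>i\<in>I. x i [^]\<^bsub>G i\<^esub> k)"
  by (induction k) (auto intro: restrict_ext)

text \<open>Finiteness of \<open>I\<close> provides a common exponent for torsion coordinates: the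
  product of their individual exponents.\<close>

lemma torsion_set_product_group:
  assumes "finite I" "\<And>i. i \<in> I \<Longrightarrow> group (G i)"
  shows "torsion_set (product_group I G) = (\<Pi>\<^sub>E i\<in>I. torsion_set (G i))"
proof
  show "torsion_set (product_group I G) \<subseteq> (\<Pi>\<^sub>E i\<in>I. torsion_set (G i))"
  proof
    fix x assume "x \<in> torsion_set (product_group I G)"
    then obtain k :: nat where k: "x \<in> carrier (product_group I G)" "k > 0"
        "(\<lambda>i\<in>I. x i [^]\<^bsub>G i\<^esub> k) = (\<lambda>i\<in>I. \<one>\<^bsub>G i\<^esub>)"
      unfolding torsion_set_def by (auto simp: nat_pow_product_group)
    have "x i [^]\<^bsub>G i\<^esub> k = \<one>\<^bsub>G i\<^esub>" if "i \<in> I" for i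
      using fun_cong[OF k(3), of i] that by simp
    then show "x \<in> (\<Pi>\<^sub>E i\<in>I. torsion_set (G i))"
      using k(1,2) unfolding torsion_set_def by (auto simp: PiE_iff)
  qed
  show "(\<Pi>\<^sub>E i\<in>I. torsion_set (G i)) \<subseteq> torsion_set (product_group I G)"
  proof
    fix x assume x: "x \<in> (\<Pi>\<^sub>E i\<in>I. torsion_set (G i))"
    then have "\<forall>i\<in>I. \<exists>k::nat. k > 0 \<and> x i [^]\<^bsub>G i\<^esub> k = \<one>\<^bsub>G i\<^esub>"
      unfolding torsion_set_def by (auto simp: PiE_iff)
    then obtain k where k: "\<And>i. i \<in> I \<Longrightarrow> k i > (0::nat)" "\<And>i. i \<in> I \<Longrightarrow> x i [^]\<^bsub>G i\<^esub> k i = \<one>\<^bsub>G i\<^esub>"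
      by metis
    define K where "K = (\<Prod>i\<in>I. k i)"
    have xc: "x \<in> carrier (product_group I G)"
      using x unfolding torsion_set_def by (auto simp: PiE_iff)
    have "x i [^]\<^bsub>G i\<^esub> K = \<one>\<^bsub>G i\<^esub>" if "i \<in> I" for i
    proof -
      interpret group "G i" using assms(2) that .
      have "x i \<in> carrier (G i)" using xc that by auto
      moreover have "k i dvd K"
        unfolding K_def using assms(1) that by (rule dvd_prodI)
      then obtain l where "K = k i * l" by (rule dvdE)
      ultimately show ?thesis using k that by (simp flip: nat_pow_pow)
    qed
    then have "x [^]\<^bsub>product_group I G\<^esub> K = \<one>\<^bsub>product_group I G\<^esub>"
      unfolding nat_pow_product_group[OF xc] by (auto intro: restrict_ext)
    moreover have "K > 0" unfolding K_def using k by (simp add: prod_pos)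
    ultimately show "x \<in> torsion_set (product_group I G)"
      unfolding torsion_set_def using xc by blast
  qed
qed

text \<open>This is an equality of groups, not merely an isomorphism, so the claim about powers of
  torsion groups becomes one about the torsion of powers.\<close>

lemma torsion_group_dpow:
  assumes "group H"
  shows "dpow (torsion_group H) n = torsion_group (dpow H n)"
proof -
  have "torsion_set (product_group {1..n} (\<lambda>_. H)) = ({1..n} \<rightarrow>\<^sub>E torsion_set H)"
    using assms by (intro torsion_set_product_group) auto
  then show ?thesis by (simp add: dpow_def torsion_group_def product_group_def)
qed

lemma comm_group_dpow:
  assumes "comm_group H" shows "comm_group (dpow H n)"
proof -
  interpret comm_group H by fact
  show ?thesis unfolding dpow_def
    by (rule group.group_comm_groupI) (auto simp: m_comm PiE_iff intro!: restrict_ext)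
qed

section \<open>Isomorphism invariance of torsion and the rank of a power\<close>

text \<open>An isomorphism commutes with powers, and by injectivity a power is trivial exactly when
  its image is.\<close>

lemma iso_torsion_set_iff:
  assumes "group A" "group B" "f \<in> iso A B" "x \<in> carrier A"
  shows "f x \<in> torsion_set B \<longleftrightarrow> x \<in> torsion_set A"
proof -
  interpret f: group_hom A B f
    using assms by (simp add: group_hom_def group_hom_axioms_def iso_def)
  have "f (x [^]\<^bsub>A\<^esub> k) = \<one>\<^bsub>B\<^esub> \<longleftrightarrow> x [^]\<^bsub>A\<^esub> k = \<one>\<^bsub>A\<^esub>" for k :: nat
    using assms f.hom_one f.G.nat_pow_closed f.G.one_closed unfolding iso_def bij_betw_def
    by (smt (verit) inj_on_eq_iff mem_Collect_eq)
  then show ?thesis unfolding torsion_set_def using assms by (simp add: f.hom_nat_pow)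
qed

lemma torsion_group_iso:
  assumes "group A" "group B" "A \<cong> B"
  shows "torsion_group A \<cong> torsion_group B"
proof -
  obtain f where f: "f \<in> iso A B" using assms(3) unfolding is_iso_def by blast
  have "f ` torsion_set A = torsion_set B"
  proof
    show "f ` torsion_set A \<subseteq> torsion_set B"
      using iso_torsion_set_iff[OF assms(1,2) f] by (auto simp: torsion_set_def)
    show "torsion_set B \<subseteq> f ` torsion_set A"
    proof
      fix y assume y: "y \<in> torsion_set B"
      then have "y \<in> f ` carrier A" using f by (auto simp: iso_def bij_betw_def torsion_set_def)
      then show "y \<in> f ` torsion_set A"
        using y iso_torsion_set_iff[OF assms(1,2) f] by auto
    qed
  qed
  moreover have "inj_on f (torsion_set A)"
    using f by (auto simp: iso_def bij_betw_def torsion_set_def intro: inj_on_subset)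
  moreover have "f (x \<otimes>\<^bsub>A\<^esub> y) = f x \<otimes>\<^bsub>B\<^esub> f y" if "x \<in> torsion_set A" "y \<in> torsion_set A" for x y
    using f that by (auto simp: iso_def hom_def torsion_set_def)
  ultimately have "f \<in> iso (torsion_group A) (torsion_group B)"
    unfolding torsion_group_def by (intro isoI homI) (auto simp: bij_betw_def)
  then show ?thesis by (rule is_isoI)
qed

text \<open>First isomorphism theorem for the isomorphism followed by the quotient map of
  \<open>B\<close>: this composite is surjective with kernel \<open>torsion_set A\<close>.\<close>

lemma Mod_torsion_set_iso:
  assumes "comm_group A" "comm_group B" "A \<cong> B"
  shows "A Mod torsion_set A \<cong> B Mod torsion_set B"
proof -
  interpret A: comm_group A by fact
  interpret B: comm_group B by fact
  interpret N: normal "torsion_set B" B by (rule B.torsion_set_normal)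
  obtain f where f: "f \<in> iso A B" using assms(3) unfolding is_iso_def by blast
  let ?q = "\<lambda>x. torsion_set B #>\<^bsub>B\<^esub> f x"
  have fc: "f x \<in> carrier B" if "x \<in> carrier A" for x
    using f that by (auto simp: iso_def hom_def)
  have "?q \<in> hom A (B Mod torsion_set B)"
    using hom_compose[OF _ N.r_coset_hom_Mod, of f A] f by (simp add: iso_def comp_def)
  then interpret q: group_hom A "B Mod torsion_set B" ?q
    by (simp add: group_hom_def group_hom_axioms_def N.factorgroup_is_group)
  have "?q ` carrier A = (\<lambda>y. torsion_set B #>\<^bsub>B\<^esub> y) ` carrier B"
    using f by (simp add: iso_def bij_betw_def flip: image_image)
  then have "?q ` carrier A = carrier (B Mod torsion_set B)"
    by (auto simp: carrier_FactGroup)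
  moreover have "kernel A (B Mod torsion_set B) ?q = torsion_set A"
  proof -
    have "?q x = torsion_set B \<longleftrightarrow> x \<in> torsion_set A" if "x \<in> carrier A" for x
      using iso_torsion_set_iff[OF A.is_group B.is_group f that] fc[OF that]
      by (simp add: B.torsion_set_coset_iff)
    then have "kernel A (B Mod torsion_set B) ?q = {x \<in> carrier A. x \<in> torsion_set A}"
      unfolding kernel_def one_FactGroup by blast
    also have "\<dots> = torsion_set A" by (auto simp: torsion_set_def)
    finally show ?thesis .
  qed
  ultimately show ?thesis using q.FactGroup_iso by simp
qed

text \<open>First isomorphism theorem for the coordinatewise quotient map \<open>?q\<close>.
  Representatives chosen in each coordinate give surjectivity; the kernel consists of the tuples
  with torsion coordinates, which is the torsion of the power.\<close>

lemma dpow_Mod_torsion_set_iso: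
  fixes H :: "('a, 'b) monoid_scheme"
  assumes "comm_group H"
  shows "dpow H n Mod torsion_set (dpow H n) \<cong> dpow (H Mod torsion_set H) n"
proof -
  interpret H: comm_group H by fact
  interpret N: normal "torsion_set H" H by (rule H.torsion_set_normal)
  interpret P: comm_group "dpow H n" by (rule comm_group_dpow) fact
  let ?Q = "H Mod torsion_set H"
  let ?q = "\<lambda>x. \<lambda>i\<in>{1..n}. torsion_set H #>\<^bsub>H\<^esub> x i"
  have Q: "group ?Q" by (rule N.factorgroup_is_group)
  have "?q \<in> hom (dpow H n) (dpow ?Q n)"
    using hom_mult[OF N.r_coset_hom_Mod] hom_in_carrier[OF N.r_coset_hom_Mod]
    by (intro homI) (auto simp: dpow_def PiE_iff carrier_FactGroup intro!: restrict_ext)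
  then interpret q: group_hom "dpow H n" "dpow ?Q n" ?q
    using Q by (simp add: group_hom_def group_hom_axioms_def dpow_def)
  have "?q ` carrier (dpow H n) \<subseteq> carrier (dpow ?Q n)"
    by (rule image_subsetI) (rule q.hom_closed)
  moreover have "carrier (dpow ?Q n) \<subseteq> ?q ` carrier (dpow H n)"
  proof
    fix Y assume Y: "Y \<in> carrier (dpow ?Q n)"
    then have "\<forall>i\<in>{1..n}. \<exists>y. y \<in> carrier H \<and> Y i = torsion_set H #>\<^bsub>H\<^esub> y"
      by (auto simp: dpow_def PiE_iff carrier_FactGroup)
    then obtain y where y: "\<And>i. i \<in> {1..n} \<Longrightarrow> y i \<in> carrier H \<and> Y i = torsion_set H #>\<^bsub>H\<^esub> y i"
      by metis
    show "Y \<in> ?q ` carrier (dpow H n)"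
    proof
      show "Y = ?q (restrict y {1..n})"
        using Y y by (auto simp: dpow_def PiE_iff extensional_def fun_eq_iff)
      show "restrict y {1..n} \<in> carrier (dpow H n)" using y by (auto simp: dpow_def)
    qed
  qed
  ultimately have "?q ` carrier (dpow H n) = carrier (dpow ?Q n)" by (rule subset_antisym)
  then have "dpow H n Mod kernel (dpow H n) (dpow ?Q n) ?q \<cong> dpow ?Q n" by (rule q.FactGroup_iso)
  moreover have "kernel (dpow H n) (dpow ?Q n) ?q = torsion_set (dpow H n)"
  proof -
    have restrict_PiE: "{x \<in> I \<rightarrow>\<^sub>E C. \<forall>i\<in>I. x i \<in> T} = I \<rightarrow>\<^sub>E T"
      if "T \<subseteq> C" for I :: "nat set" and T C :: "'a set"
      using that by (simp add: set_eq_iff PiE_iff) blast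
    have tors: "torsion_set (dpow H n) = (\<Pi>\<^sub>E i\<in>{1..n}. torsion_set H)"
      unfolding dpow_def by (rule torsion_set_product_group) auto
    have "?q x = \<one>\<^bsub>dpow ?Q n\<^esub> \<longleftrightarrow> (\<forall>i\<in>{1..n}. x i \<in> torsion_set H)" if "x \<in> carrier (dpow H n)" for x
    proof -
      have "?q x = \<one>\<^bsub>dpow ?Q n\<^esub> \<longleftrightarrow> (\<forall>i\<in>{1..n}. torsion_set H #>\<^bsub>H\<^esub> x i = torsion_set H)"
        by (auto simp: dpow_def fun_eq_iff restrict_def)
      also have "\<dots> \<longleftrightarrow> (\<forall>i\<in>{1..n}. x i \<in> torsion_set H)"
        using that by (auto simp: dpow_def PiE_iff H.torsion_set_coset_iff)
      finally show ?thesis .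
    qed
    then have "kernel (dpow H n) (dpow ?Q n) ?q
        = {x \<in> carrier (dpow H n). \<forall>i\<in>{1..n}. x i \<in> torsion_set H}"
      unfolding kernel_def by blast
    also have "\<dots> = torsion_set (dpow H n)"
      unfolding tors by (simp only: dpow_def carrier_product_group restrict_PiE[OF N.subset])
    finally show ?thesis .
  qed
  ultimately show ?thesis by (simp only:)
qed

text \<open>Modulo torsion both powers are free, on bases of \<open>n * ab_rank H\<close> and
  \<open>m * ab_rank K\<close> elements, and isomorphic free abelian groups have bases of equal
  size.\<close>

lemma ab_rank_dpow_iso:
  assumes "comm_group H" "fin_gen_group H" "comm_group K" "fin_gen_group K" "dpow H n \<cong> dpow K m"
  shows "ab_rank H * n = ab_rank K * m"
proof -
  \<comment> \<open>\<open>L\<close> has its own type variables, so the fact applies to both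
    \<open>H\<close> and \<open>K\<close>.\<close>
  have free: "dpow L k Mod torsion_set (dpow L k) \<cong> free_Abelian_group ({1..k} \<times> {1..ab_rank L})"
    if L: "comm_group L" "fin_gen_group L" for L :: "('x, 'y) monoid_scheme" and k
  proof -
    interpret L: comm_group L by fact
    interpret N: normal "torsion_set L" L by (rule L.torsion_set_normal)
    have "dpow L k Mod torsion_set (dpow L k) \<cong> dpow (L Mod torsion_set L) k"
      by (rule dpow_Mod_torsion_set_iso) fact
    also have "\<dots> \<cong> dpow (product_group {1..ab_rank L} (\<lambda>_. integer_group)) k"
      unfolding dpow_def
      by (rule iso_product_groupI)
        (use L.Mod_torsion_set_iso_ab_rank[OF L(2)] N.factorgroup_is_group in simp_all)
    also have "\<dots> \<cong> free_Abelian_group ({1..k} \<times> {1..ab_rank L})"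
      unfolding dpow_def by (rule product_integer_group_power_iso) auto
    finally show ?thesis .
  qed
  let ?Q = "dpow H n Mod torsion_set (dpow H n)"
  have "group ?Q"
    using comm_group.torsion_set_normal[OF comm_group_dpow[OF assms(1)]]
    by (rule normal.factorgroup_is_group)
  then have "free_Abelian_group ({1..n} \<times> {1..ab_rank H}) \<cong> ?Q"
    using free[OF assms(1,2)] by (rule group.iso_sym)
  also have "?Q \<cong> dpow K m Mod torsion_set (dpow K m)"
    using assms by (intro Mod_torsion_set_iso comm_group_dpow)
  also have "\<dots> \<cong> free_Abelian_group ({1..m} \<times> {1..ab_rank K})"
    by (rule free) fact+
  finally show ?thesis
    by (simp add: isomorphic_free_Abelian_groups eqpoll_iff_card card_cartesian_product mult.commute)
qed

section \<open>Permutational wreath products\<close>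

text \<open>The setting of a single wreath product, to be interpreted once for each side of the
  isomorphism.\<close>

locale perm_wreath = H: comm_group H + G: group G
  for H :: "('h, 'hb) monoid_scheme" and G :: "('g, 'gb) monoid_scheme" +
  fixes n :: nat and \<sigma> :: "'g \<Rightarrow> nat \<Rightarrow> nat"
  assumes \<sigma>_hom: "\<sigma> \<in> hom G (sym_group n)"
begin

abbreviation "W \<equiv> wreath_sdp H n G \<sigma>"
abbreviation "act \<equiv> perm_act G \<sigma> n"

sublocale P: comm_group "dpow H n"
  by (rule comm_group_dpow) (rule H.comm_group_axioms)

lemma \<sigma>_permutes: "g \<in> carrier G \<Longrightarrow> \<sigma> g permutes {1..n}"
  using hom_in_carrier[OF \<sigma>_hom] by (simp add: sym_group_def)

lemma \<sigma>_mem: "g \<in> carrier G \<Longrightarrow> i \<in> {1..n} \<Longrightarrow> \<sigma> g i \<in> {1..n}"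
  using permutes_in_image[OF \<sigma>_permutes] by blast

lemma \<sigma>_mult: "g \<in> carrier G \<Longrightarrow> g' \<in> carrier G \<Longrightarrow> \<sigma> (g \<otimes>\<^bsub>G\<^esub> g') i = \<sigma> g (\<sigma> g' i)"
  using hom_mult[OF \<sigma>_hom] by (simp add: sym_group_def)

lemma \<sigma>_one: "\<sigma> \<one>\<^bsub>G\<^esub> = id"
  using hom_one[OF \<sigma>_hom G.is_group sym_group_is_group] by (simp add: sym_group_def)

lemma act_closed:
  assumes "g \<in> carrier G" "h \<in> carrier (dpow H n)" shows "act g h \<in> carrier (dpow H n)"
  using assms \<sigma>_mem[OF G.inv_closed[OF assms(1)]]
  by (auto simp: perm_act_def dpow_def PiE_iff simp del: One_nat_def atLeastAtMost_iff)

lemma act_mult: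
  assumes "g \<in> carrier G"
  shows "act g (h \<otimes>\<^bsub>dpow H n\<^esub> h') = act g h \<otimes>\<^bsub>dpow H n\<^esub> act g h'"
  using \<sigma>_mem[OF G.inv_closed[OF assms(1)]]
  by (auto simp: perm_act_def dpow_def intro!: restrict_ext simp del: One_nat_def atLeastAtMost_iff)

text \<open>Precomposition with permutations reverses products, and so does inversion; the inverse
  in \<open>perm_act\<close> therefore yields a left action.\<close>

lemma act_comp:
  assumes "g \<in> carrier G" "g' \<in> carrier G"
  shows "act (g \<otimes>\<^bsub>G\<^esub> g') h = act g (act g' h)"
  using assms \<sigma>_mem[OF G.inv_closed[OF assms(1)]]
  by (auto simp: perm_act_def G.inv_mult_group \<sigma>_mult intro!: restrict_ext
      simp del: One_nat_def atLeastAtMost_iff)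

lemma act_one:
  assumes "h \<in> carrier (dpow H n)" shows "act \<one>\<^bsub>G\<^esub> h = h"
  using assms by (simp add: perm_act_def \<sigma>_one dpow_def PiE_iff extensional_restrict)

lemma carrier_W: "carrier W = carrier (dpow H n) \<times> carrier G"
  by (simp add: wreath_sdp_def)

lemma one_W: "\<one>\<^bsub>W\<^esub> = (\<one>\<^bsub>dpow H n\<^esub>, \<one>\<^bsub>G\<^esub>)"
  by (simp add: wreath_sdp_def)

lemma mult_W: "(h, g) \<otimes>\<^bsub>W\<^esub> (h', g') = (h \<otimes>\<^bsub>dpow H n\<^esub> act g h', g \<otimes>\<^bsub>G\<^esub> g')"
  by (simp add: wreath_sdp_def)

lemma group_W: "group W"
proof (rule groupI)
  fix x assume "x \<in> carrier W"
  then obtain h g where x: "x = (h, g)" "h \<in> carrier (dpow H n)" "g \<in> carrier G"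
    by (auto simp: carrier_W)
  \<comment> \<open>The left inverse of \<open>(h, g)\<close>: the second component must be the
    inverse of \<open>g\<close>, which then acts on \<open>h\<close> in the product and has to be
    cancelled.\<close>
  let ?y = "(act (inv\<^bsub>G\<^esub> g) (inv\<^bsub>dpow H n\<^esub> h), inv\<^bsub>G\<^esub> g)"
  have "act (inv\<^bsub>G\<^esub> g) (inv\<^bsub>dpow H n\<^esub> h) \<otimes>\<^bsub>dpow H n\<^esub> act (inv\<^bsub>G\<^esub> g) h
      = act (inv\<^bsub>G\<^esub> g) \<one>\<^bsub>dpow H n\<^esub>"
    using x by (simp flip: act_mult)
  also have "\<dots> = \<one>\<^bsub>dpow H n\<^esub>"
    \<comment> \<open>The image of the identity under the action is idempotent, hence
      trivial.\<close>
    using x act_mult[of "inv\<^bsub>G\<^esub> g" "\<one>\<^bsub>dpow H n\<^esub>" "\<one>\<^bsub>dpow H n\<^esub>"] act_closed[of "inv\<^bsub>G\<^esub> g" "\<one>\<^bsub>dpow H n\<^esub>"]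
    by simp
  finally have "?y \<otimes>\<^bsub>W\<^esub> x = \<one>\<^bsub>W\<^esub>" using x by (simp add: mult_W one_W)
  then show "\<exists>y\<in>carrier W. y \<otimes>\<^bsub>W\<^esub> x = \<one>\<^bsub>W\<^esub>"
    using x act_closed by (intro bexI[of _ ?y]) (auto simp: carrier_W)
qed (auto simp: carrier_W mult_W one_W act_closed act_mult act_comp act_one P.m_assoc G.m_assoc)

sublocale W: group W by (rule group_W)

text \<open>The projection exhibits the base as a kernel, which yields its normality and identifies
  the quotient with \<open>G\<close>.\<close>

lemma snd_hom: "snd \<in> hom W G"
  by (rule homI) (auto simp: carrier_W mult_W)

lemma snd_surj: "snd ` carrier W = carrier G"
  using P.one_closed by (force simp: carrier_W)

lemma snd_kernel: "kernel W G snd = base_sub H n G"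
  by (auto simp: kernel_def base_sub_def carrier_W)

sublocale snd: group_hom W G snd
  by unfold_locales (rule snd_hom)

lemma base_sub_mult:
  assumes "x \<in> base_sub H n G" "y \<in> base_sub H n G"
  shows "x \<otimes>\<^bsub>W\<^esub> y = (fst x \<otimes>\<^bsub>dpow H n\<^esub> fst y, \<one>\<^bsub>G\<^esub>)"
  using assms by (auto simp: base_sub_def mult_W act_one)

text \<open>Normal as the kernel of \<open>snd\<close>; commutative because the identity of
  \<open>G\<close> acts trivially, so that products in the base are those of the abelian group
  \<open>dpow H n\<close>.\<close>

lemma base_sub_abelian_normal: "abelian_normal (base_sub H n G) W"
  unfolding abelian_normal_def
proof (intro conjI ballI)
  show "base_sub H n G \<lhd> W" using snd.normal_kernel snd_kernel by simp
  fix x y assume "x \<in> base_sub H n G" "y \<in> base_sub H n G"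
  then show "x \<otimes>\<^bsub>W\<^esub> y = y \<otimes>\<^bsub>W\<^esub> x"
    by (simp add: base_sub_mult) (auto simp: base_sub_def intro: P.m_comm)
qed

text \<open>On all of \<open>W\<close> the map \<open>fst\<close> is only a crossed homomorphism; on
  the base the action disappears and it becomes multiplicative.\<close>

lemma fst_iso: "fst \<in> iso (W\<lparr>carrier := base_sub H n G\<rparr>) (dpow H n)"
  by (rule isoI, rule homI) (auto simp: base_sub_mult, auto simp: base_sub_def bij_betw_def inj_on_def image_iff)

end

section \<open>Isomorphisms between wreath products\<close>

lemma abelian_normal_iso_img:
  assumes "group A" "group B" "f \<in> iso A B" "abelian_normal N A"
  shows "abelian_normal (f ` N) B"
proof -
  have "N \<lhd> A" and comm: "\<And>x y. x \<in> N \<Longrightarrow> y \<in> N \<Longrightarrow> x \<otimes>\<^bsub>A\<^esub> y = y \<otimes>\<^bsub>A\<^esub> x"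
    using assms(4) by (auto simp: abelian_normal_def)
  then interpret N: normal N A by simp
  have "f ` N \<lhd> B" using assms(1-3) \<open>N \<lhd> A\<close> by (intro iso_normal_subgroup[of f A])
  moreover have "f x \<otimes>\<^bsub>B\<^esub> f y = f y \<otimes>\<^bsub>B\<^esub> f x" if "x \<in> N" "y \<in> N" for x y
  proof -
    have "f \<in> hom A B" using assms(3) by (simp add: iso_def)
    then show ?thesis
      using comm[OF that] N.mem_carrier[OF that(1)] N.mem_carrier[OF that(2)]
      by (simp flip: hom_mult)
  qed
  ultimately show ?thesis by (auto simp: abelian_normal_def)
qed

theorem theorem3p19:
  fixes H :: "('h, 'hb) monoid_scheme" and K :: "('k, 'kb) monoid_scheme"
    and G :: "('g, 'gb) monoid_scheme" and G' :: "('g2, 'gb2) monoid_scheme"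
    and \<sigma> :: "'g \<Rightarrow> nat \<Rightarrow> nat" and \<sigma>' :: "'g2 \<Rightarrow> nat \<Rightarrow> nat"
    and n m :: nat and \<Phi> :: "(nat \<Rightarrow> 'h) \<times> 'g \<Rightarrow> (nat \<Rightarrow> 'k) \<times> 'g2"
  assumes "comm_group H" "fin_gen_group H" "carrier H \<noteq> {\<one>\<^bsub>H\<^esub>}"
    and "comm_group K" "fin_gen_group K" "carrier K \<noteq> {\<one>\<^bsub>K\<^esub>}"
    and "group G" "carrier G \<noteq> {\<one>\<^bsub>G\<^esub>}"
    and "group G'" "carrier G' \<noteq> {\<one>\<^bsub>G'\<^esub>}"
    and "n \<ge> 3" "m \<ge> 3"
    and "\<sigma> \<in> hom G (sym_group n)" "\<sigma> ` carrier G = carrier (sym_group n)"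
    and "\<sigma>' \<in> hom G' (sym_group m)" "\<sigma>' ` carrier G' = carrier (sym_group m)"
    and "\<forall>N. abelian_normal N (wreath_sdp H n G \<sigma>) \<longrightarrow> N \<subseteq> base_sub H n G"
    and "\<forall>N. abelian_normal N (wreath_sdp K m G' \<sigma>') \<longrightarrow> N \<subseteq> base_sub K m G'"
    and "\<Phi> \<in> iso (wreath_sdp H n G \<sigma>) (wreath_sdp K m G' \<sigma>')"
  shows "\<Phi> ` base_sub H n G = base_sub K m G' \<and>
         dpow H n \<cong> dpow K m \<and>
         ab_rank H * n = ab_rank K * m \<and>
         dpow (torsion_group H) n \<cong> dpow (torsion_group K) m \<and>
         G \<cong> G'"
proof -
  interpret X: perm_wreath H G n \<sigma>
    using assms by (simp add: perm_wreath_def perm_wreath_axioms_def)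
  interpret Y: perm_wreath K G' m \<sigma>'
    using assms by (simp add: perm_wreath_def perm_wreath_axioms_def)
  let ?B = "base_sub H n G" and ?B' = "base_sub K m G'"
  let ?\<Psi> = "inv_into (carrier X.W) \<Phi>"
  note iso = assms(19)
  have \<Phi>: "\<Phi> \<in> hom X.W Y.W" "bij_betw \<Phi> (carrier X.W) (carrier Y.W)"
    using iso by (auto simp: iso_def)
  have sub: "?B \<subseteq> carrier X.W" "?B' \<subseteq> carrier Y.W"
    by (auto simp: base_sub_def X.carrier_W Y.carrier_W)
  \<comment> \<open>Each base contains every abelian normal subgroup of its group. Applying this to
    the image of one base under \<open>\<Phi>\<close>, and of the other under its inverse
    \<open>?\<Psi>\<close>, gives the two inclusions.\<close>
  have img: "\<Phi> ` ?B = ?B'"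
  proof
    show "\<Phi> ` ?B \<subseteq> ?B'"
      using assms(18) abelian_normal_iso_img[OF X.group_W Y.group_W iso X.base_sub_abelian_normal]
      by blast
    have "?\<Psi> ` ?B' \<subseteq> ?B"
      using assms(17) abelian_normal_iso_img[OF Y.group_W X.group_W
          X.W.iso_set_sym[OF iso] Y.base_sub_abelian_normal]
      by blast
    then show "?B' \<subseteq> \<Phi> ` ?B"
      using \<Phi>(2) sub(2) by (metis bij_betw_imp_surj_on image_inv_into_cancel image_mono)
  qed
  have "\<Phi> \<in> iso (X.W\<lparr>carrier := ?B\<rparr>) (Y.W\<lparr>carrier := ?B'\<rparr>)"
  proof (rule isoI)
    show "\<Phi> \<in> hom (X.W\<lparr>carrier := ?B\<rparr>) (Y.W\<lparr>carrier := ?B'\<rparr>)"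
      using sub img by (intro homI) (auto simp: hom_mult[OF \<Phi>(1)] subset_iff)
    show "bij_betw \<Phi> (carrier (X.W\<lparr>carrier := ?B\<rparr>)) (carrier (Y.W\<lparr>carrier := ?B'\<rparr>))"
      using bij_betw_subset[OF \<Phi>(2) sub(1) img] by simp
  qed
  \<comment> \<open>The restriction of \<open>\<Phi>\<close> to the bases is followed by the
    identification of the second base with \<open>dpow K m\<close>.\<close>
  then have base: "X.W\<lparr>carrier := ?B\<rparr> \<cong> dpow K m"
    by (rule iso_trans[OF is_isoI is_isoI[OF Y.fst_iso]])
  have "dpow H n \<cong> X.W\<lparr>carrier := ?B\<rparr>"
  proof (rule group.iso_sym[OF _ is_isoI[OF X.fst_iso]])
    show "group (X.W\<lparr>carrier := ?B\<rparr>)"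
      using X.W.subgroup_imp_group[OF X.snd.subgroup_kernel] X.snd_kernel by simp
  qed
  then have pow: "dpow H n \<cong> dpow K m" using base by (rule iso_trans)
  have "dpow (torsion_group H) n \<cong> dpow (torsion_group K) m"
    using torsion_group_iso[OF X.P.is_group Y.P.is_group pow]
    by (simp add: torsion_group_dpow X.H.is_group Y.H.is_group)
  moreover have "G \<cong> G'"
  proof -
    have "G \<cong> X.W Mod ?B"
      using X.snd.FactGroup_iso[OF X.snd_surj] X.snd_kernel
        normal.factorgroup_is_group[OF X.snd.normal_kernel] by (simp add: group.iso_sym)
    moreover have "X.W Mod ?B \<cong> G'"
    proof -
      \<comment> \<open>Instead of building a map between quotients, the first isomorphism theorem
        is applied to the surjection \<open>snd \<circ> \<Phi>\<close>, whose kernel is the preimage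
        of \<open>?B'\<close>.\<close>
      interpret q: group_hom X.W G' "snd \<circ> \<Phi>"
        using hom_compose[OF \<Phi>(1) Y.snd_hom] by unfold_locales
      have "(snd \<circ> \<Phi>) ` carrier X.W = carrier G'"
        using Y.snd_surj \<Phi>(2) by (simp add: bij_betw_def flip: image_image)
      moreover have "kernel X.W G' (snd \<circ> \<Phi>) = ?B"
      proof -
        have "kernel X.W G' (snd \<circ> \<Phi>) = {x \<in> carrier X.W. \<Phi> x \<in> ?B'}"
          using hom_in_carrier[OF \<Phi>(1)] unfolding Y.snd_kernel[symmetric] kernel_def by auto
        \<comment> \<open>As \<open>?B'\<close> is the image of \<open>?B\<close>, injectivity of
          \<open>\<Phi>\<close> shows that its preimage is no larger than \<open>?B\<close>.\<close>
        also have "\<dots> = ?B"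
          using img sub(1) \<Phi>(2) unfolding bij_betw_def inj_on_def by blast
        finally show ?thesis .
      qed
      ultimately show ?thesis using q.FactGroup_iso by simp
    qed
    ultimately show ?thesis by (rule iso_trans)
  qed
  moreover have "ab_rank H * n = ab_rank K * m"
    using assms(1,2,4,5) pow by (rule ab_rank_dpow_iso)
  ultimately show ?thesis using img pow by (intro conjI)
qed

end
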